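(* Let $X$ be a locale and $R$ a localic relation on $X$ with open cones. Then the induced cones $\Uparrow_R,\Downarrow_R\colon\mathcal{O}X\to\mathcal{O}X$ are parallel, i.e. for all $U,V\in\mathcal{O}X$: $\Uparrow_R U\wedge V\sqsubseteq\Uparrow_R(U\wedge\Downarrow_R V)$ and $U\wedge\Downarrow_R V\sqsubseteq\Downarrow_R(\Uparrow_R U\wedge V)$.
   Context: The category of locales is the opposite of the category of frames: a locale $X$ has a frame of opens $\mathcal{O}X$ (order $\sqsubseteq$), and a map $f\colon X\to Y$ is a frame map $f^{-1}\colon\mathcal{O}Y\to\mathcal{O}X$ (preserving finite meets and all joins). A localic relation on $X$ is a sublocale (extremal monomorphism, equivalently a map whose frame map is surjective) $r\colon R\rightarrowtail X\times X$; its source and target maps are $s=\mathrm{pr}_1\circ r$, $t=\mathrm{pr}_2\circ r\colon R\to X$. A locale map $f\colon X\to Y$ is open if $f^{-1}$ has a left adjoint $f_!$ with $f_!(U\wedge f^{-1}(V))=f_!(U)\wedge V$. $R$ has open cones if $s,t$ are open; then its induced cones are $\Uparrow_R:=t_!s^{-1}$ and $\Downarrow_R:=s_!t^{-1}\colon\mathcal{O}X\to\mathcal{O}X$. *)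

theory Defs
  imports Main
begin

text \<open>
  A locale is represented by its frame of opens, given as a type of class \<open>frame\<close>, and a locale
  map \<open>X \<rightarrow> Y\<close> by its inverse image map, a function from the opens of \<open>Y\<close> to the opens of \<open>X\<close>.
  (The library class \<open>complete_distrib_lattice\<close> demands complete distributivity, which is
  strictly stronger than the frame law.)
\<close>

class frame = complete_lattice +
  assumes inf_Sup_frame: "inf a (Sup B) = Sup (inf a ` B)"

definition frame_map :: "('a::frame \<Rightarrow> 'b::frame) \<Rightarrow> bool" where
  "frame_map f \<longleftrightarrow>
     f top = top \<and> (\<forall>U V. f (inf U V) = inf (f U) (f V)) \<and> (\<forall>A. f (Sup A) = Sup (f ` A))"

definition left_adjoint :: "('a::order \<Rightarrow> 'b::order) \<Rightarrow> ('b \<Rightarrow> 'a) \<Rightarrow> bool" where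
  "left_adjoint g f \<longleftrightarrow> (\<forall>U V. g U \<le> V \<longleftrightarrow> U \<le> f V)"

text \<open>The argument is the inverse image map of the locale map in question.\<close>

definition open_locale_map :: "('a::frame \<Rightarrow> 'b::frame) \<Rightarrow> bool" where
  "open_locale_map f \<longleftrightarrow> frame_map f \<and>
     (\<exists>g. left_adjoint g f \<and> (\<forall>U V. g (inf U (f V)) = inf (g U) V))"

text \<open>\<open>f\<^sub>!\<close>; specified only when the left adjoint exists, in which case it is unique.\<close>

definition direct_image :: "('a::order \<Rightarrow> 'b::order) \<Rightarrow> 'b \<Rightarrow> 'a" where
  "direct_image f = (THE g. left_adjoint g f)"

lemma left_adjoint_unique:
  fixes f :: "'a::order \<Rightarrow> 'b::order"
  assumes "left_adjoint g f" "left_adjoint h f"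
  shows "g = h"
proof
  fix U
  have "g U \<le> V \<longleftrightarrow> h U \<le> V" for V
    using assms unfolding left_adjoint_def by simp
  then show "g U = h U"
    by (meson order.antisym order.refl)
qed

lemma direct_image_eq: "left_adjoint g f \<Longrightarrow> direct_image f = g"
  unfolding direct_image_def by (blast intro: left_adjoint_unique)


subsection \<open>Product locales\<close>

text \<open>
  The frame of opens of a product of locales is the coproduct of their frames of opens, here
  constructed as the frame of C-ideals. The case \<open>S = {}\<close> puts all \<open>(bot, v)\<close> and \<open>(u, bot)\<close>
  into every C-ideal.
\<close>

definition c_ideal :: "('a::frame \<times> 'b::frame) set \<Rightarrow> bool" where
  "c_ideal D \<longleftrightarrow>
     (\<forall>u v u' v'. (u, v) \<in> D \<longrightarrow> u' \<le> u \<longrightarrow> v' \<le> v \<longrightarrow> (u', v') \<in> D) \<and>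
     (\<forall>S v. (\<forall>u\<in>S. (u, v) \<in> D) \<longrightarrow> (Sup S, v) \<in> D) \<and>
     (\<forall>S u. (\<forall>v\<in>S. (u, v) \<in> D) \<longrightarrow> (u, Sup S) \<in> D)"

lemma
  assumes "c_ideal D"
  shows c_idealD1: "(u, v) \<in> D \<Longrightarrow> u' \<le> u \<Longrightarrow> v' \<le> v \<Longrightarrow> (u', v') \<in> D"
    and c_idealD2: "\<forall>u\<in>S. (u, v) \<in> D \<Longrightarrow> (Sup S, v) \<in> D"
    and c_idealD3: "\<forall>v\<in>T. (u, v) \<in> D \<Longrightarrow> (u, Sup T) \<in> D"
proof -
  note * = assms[unfolded c_ideal_def]
  show "(u, v) \<in> D \<Longrightarrow> u' \<le> u \<Longrightarrow> v' \<le> v \<Longrightarrow> (u', v') \<in> D"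
    using *[THEN conjunct1] by simp
  show "\<forall>u\<in>S. (u, v) \<in> D \<Longrightarrow> (Sup S, v) \<in> D"
    using *[THEN conjunct2, THEN conjunct1] by simp
  show "\<forall>v\<in>T. (u, v) \<in> D \<Longrightarrow> (u, Sup T) \<in> D"
    using *[THEN conjunct2, THEN conjunct2] by simp
qed

lemma c_ideal_Inter: "(\<And>D. D \<in> \<D> \<Longrightarrow> c_ideal D) \<Longrightarrow> c_ideal (\<Inter>\<D>)"
  unfolding c_ideal_def by (intro conjI allI impI InterI; simp (no_asm_use) add: Ball_def; meson)

typedef (overloaded) ('a::frame, 'b::frame) frame_coprod = "{D :: ('a \<times> 'b) set. c_ideal D}"
  morphisms pairs Abs_frame_coprod
  by (rule exI[of _ UNIV]) (simp add: c_ideal_def)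

setup_lifting type_definition_frame_coprod

lemma c_ideal_pairs: "c_ideal (pairs D)"
  using pairs[of D] by simp

lemma c_ideal_residual:
  assumes "c_ideal E"
  shows "c_ideal {(u, v). (inf a u, inf b v) \<in> E}"
proof -
  note dn = c_idealD1[OF assms] and s1 = c_idealD2[OF assms] and s2 = c_idealD3[OF assms]
  show ?thesis
    unfolding c_ideal_def
  proof (intro conjI allI impI)
    fix u v u' v' assume "(u, v) \<in> {(u, v). (inf a u, inf b v) \<in> E}" "u' \<le> u" "v' \<le> v"
    then show "(u', v') \<in> {(u, v). (inf a u, inf b v) \<in> E}"
      using dn[of "inf a u" "inf b v" "inf a u'" "inf b v'"] by (simp add: le_infI2)
  next
    fix S v assume "\<forall>u\<in>S. (u, v) \<in> {(u, v). (inf a u, inf b v) \<in> E}"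
    then show "(Sup S, v) \<in> {(u, v). (inf a u, inf b v) \<in> E}"
      by (simp add: inf_Sup_frame s1)
  next
    fix S u assume "\<forall>v\<in>S. (u, v) \<in> {(u, v). (inf a u, inf b v) \<in> E}"
    then show "(u, Sup S) \<in> {(u, v). (inf a u, inf b v) \<in> E}"
      by (simp add: inf_Sup_frame s2)
  qed
qed

instantiation frame_coprod :: (frame, frame) complete_lattice
begin

lift_definition less_eq_frame_coprod ::
    "('a, 'b) frame_coprod \<Rightarrow> ('a, 'b) frame_coprod \<Rightarrow> bool" is "(\<subseteq>)" .

lift_definition less_frame_coprod ::
    "('a, 'b) frame_coprod \<Rightarrow> ('a, 'b) frame_coprod \<Rightarrow> bool" is "(\<subset>)" .

lift_definition Inf_frame_coprod ::
    "('a, 'b) frame_coprod set \<Rightarrow> ('a, 'b) frame_coprod" is "\<lambda>\<D>. \<Inter>\<D>"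
  by (rule c_ideal_Inter) blast

definition Sup_frame_coprod :: "('a, 'b) frame_coprod set \<Rightarrow> ('a, 'b) frame_coprod" where
  "Sup \<D> = (Inf {E. \<forall>D\<in>\<D>. D \<le> E} :: ('a, 'b) frame_coprod)"

definition inf_frame_coprod ::
    "('a, 'b) frame_coprod \<Rightarrow> ('a, 'b) frame_coprod \<Rightarrow> ('a, 'b) frame_coprod" where
  "inf D E = (Inf {D, E} :: ('a, 'b) frame_coprod)"

definition sup_frame_coprod ::
    "('a, 'b) frame_coprod \<Rightarrow> ('a, 'b) frame_coprod \<Rightarrow> ('a, 'b) frame_coprod" where
  "sup D E = (Sup {D, E} :: ('a, 'b) frame_coprod)"

definition top_frame_coprod :: "('a, 'b) frame_coprod" where
  "top = (Inf {} :: ('a, 'b) frame_coprod)"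

definition bot_frame_coprod :: "('a, 'b) frame_coprod" where
  "bot = (Sup {} :: ('a, 'b) frame_coprod)"

instance
proof
  fix x y z :: "('a, 'b) frame_coprod" and A :: "('a, 'b) frame_coprod set"
  have low: "Inf B \<le> w" if "w \<in> B" for B and w :: "('a, 'b) frame_coprod"
    using that unfolding less_eq_frame_coprod.rep_eq Inf_frame_coprod.rep_eq by blast
  have great: "w \<le> Inf B" if "\<And>u. u \<in> B \<Longrightarrow> w \<le> u" for B and w :: "('a, 'b) frame_coprod"
    using that unfolding less_eq_frame_coprod.rep_eq Inf_frame_coprod.rep_eq by blast
  have up: "w \<le> Sup B" if "w \<in> B" for B and w :: "('a, 'b) frame_coprod"
    unfolding Sup_frame_coprod_def using that by (auto intro: great)
  have least: "Sup B \<le> w" if "\<And>u. u \<in> B \<Longrightarrow> u \<le> w" for B and w :: "('a, 'b) frame_coprod"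
    unfolding Sup_frame_coprod_def using that by (auto intro: low)
  show "(x < y) = (x \<le> y \<and> \<not> y \<le> x)"
    unfolding less_eq_frame_coprod.rep_eq less_frame_coprod.rep_eq by blast
  show "x \<le> x"
    unfolding less_eq_frame_coprod.rep_eq by blast
  show "x \<le> y \<Longrightarrow> y \<le> z \<Longrightarrow> x \<le> z"
    unfolding less_eq_frame_coprod.rep_eq by blast
  show "x \<le> y \<Longrightarrow> y \<le> x \<Longrightarrow> x = y"
    unfolding less_eq_frame_coprod.rep_eq pairs_inject[symmetric] by blast
  show "inf x y \<le> x" "inf x y \<le> y" by (auto simp: inf_frame_coprod_def intro: low)
  show "x \<le> y \<Longrightarrow> x \<le> z \<Longrightarrow> x \<le> inf y z" by (auto simp: inf_frame_coprod_def intro: great)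
  show "x \<le> sup x y" "y \<le> sup x y" by (auto simp: sup_frame_coprod_def intro: up)
  show "y \<le> x \<Longrightarrow> z \<le> x \<Longrightarrow> sup y z \<le> x" by (auto simp: sup_frame_coprod_def intro: least)
  show "x \<in> A \<Longrightarrow> Inf A \<le> x" by (rule low)
  show "(\<And>x. x \<in> A \<Longrightarrow> z \<le> x) \<Longrightarrow> z \<le> Inf A" by (rule great)
  show "x \<in> A \<Longrightarrow> x \<le> Sup A" by (rule up)
  show "(\<And>x. x \<in> A \<Longrightarrow> x \<le> z) \<Longrightarrow> Sup A \<le> z" by (rule least)
  show "Inf {} = (top :: ('a, 'b) frame_coprod)" by (simp add: top_frame_coprod_def)
  show "Sup {} = (bot :: ('a, 'b) frame_coprod)" by (simp add: bot_frame_coprod_def)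
qed

end

lemma pairs_Inf: "pairs (Inf \<D>) = \<Inter>(pairs ` \<D>)"
  by (simp add: Inf_frame_coprod.rep_eq)

lemma pairs_inf: "pairs (inf D E) = pairs D \<inter> pairs E"
  unfolding inf_frame_coprod_def pairs_Inf by simp

lemma pairs_top: "pairs top = UNIV"
  unfolding top_frame_coprod_def pairs_Inf by simp

lemma pairs_Abs: "c_ideal D \<Longrightarrow> pairs (Abs_frame_coprod D) = D"
  by (simp add: Abs_frame_coprod_inverse)

lemmas pairs_down = c_idealD1[OF c_ideal_pairs]
lemmas pairs_Sup1 = c_idealD2[OF c_ideal_pairs]
lemmas pairs_Sup2 = c_idealD3[OF c_ideal_pairs]

instance frame_coprod :: (frame, frame) frame
proof
  fix D :: "('a, 'b) frame_coprod" and \<E> :: "('a, 'b) frame_coprod set"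
  show "inf D (Sup \<E>) = Sup (inf D ` \<E>)"
  proof (rule order.antisym)
    let ?K = "Sup (inf D ` \<E>)"
    let ?H = "\<Inter>(a, b)\<in>pairs D. {(u, v). (inf a u, inf b v) \<in> pairs ?K}"
    have "c_ideal ?H"
      by (rule c_ideal_Inter) (auto intro: c_ideal_residual c_ideal_pairs)
    note H = pairs_Abs[OF this]
    have "E \<le> Abs_frame_coprod ?H" if "E \<in> \<E>" for E
    proof -
      have "inf D E \<le> ?K" using that by (simp add: Sup_upper)
      then have "pairs D \<inter> pairs E \<subseteq> pairs ?K"
        by (simp add: less_eq_frame_coprod.rep_eq pairs_inf)
      moreover have "(inf a u, inf b v) \<in> pairs D \<inter> pairs E"
        if "(a, b) \<in> pairs D" "(u, v) \<in> pairs E" for a b u v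
        using pairs_down[OF that(1), of "inf a u" "inf b v"]
          pairs_down[OF that(2), of "inf a u" "inf b v"] by simp
      ultimately show ?thesis
        unfolding less_eq_frame_coprod.rep_eq H by blast
    qed
    then have "Sup \<E> \<le> Abs_frame_coprod ?H" by (rule Sup_least)
    then have sub: "pairs (Sup \<E>) \<subseteq> ?H" unfolding less_eq_frame_coprod.rep_eq H .
    show "inf D (Sup \<E>) \<le> ?K"
      unfolding less_eq_frame_coprod.rep_eq pairs_inf
    proof
      fix p assume p: "p \<in> pairs D \<inter> pairs (Sup \<E>)"
      obtain u v where uv: "p = (u, v)" by fastforce
      from p sub have "(inf u u, inf v v) \<in> pairs ?K" unfolding uv by blast
      then show "p \<in> pairs ?K" unfolding uv by simp
    qed
  next
    show "Sup (inf D ` \<E>) \<le> inf D (Sup \<E>)"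
      by (rule Sup_least) (auto intro: le_infI2 Sup_upper)
  qed
qed

text \<open>\<open>open_rect U V\<close> is the C-ideal generated by \<open>(U, V)\<close>, i.e. the open \<open>U \<times> V\<close>.\<close>

definition open_rect :: "'a::frame \<Rightarrow> 'b::frame \<Rightarrow> ('a, 'b) frame_coprod" where
  "open_rect U V = Inf {D. (U, V) \<in> pairs D}"

definition pr1_inv :: "'a::frame \<Rightarrow> ('a, 'b::frame) frame_coprod" where
  "pr1_inv U = open_rect U top"

definition pr2_inv :: "'b::frame \<Rightarrow> ('a::frame, 'b) frame_coprod" where
  "pr2_inv V = open_rect top V"


subsection \<open>The universal property of the product\<close>

lemma pairs_open_rect:
  "pairs (open_rect U V) = {(u, v). u = bot \<or> v = bot \<or> u \<le> U \<and> v \<le> V}" (is "_ = ?R")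
proof
  have "c_ideal ?R"
    unfolding c_ideal_def
  proof (intro conjI allI impI)
    fix S v assume *: "\<forall>u\<in>S. (u, v) \<in> ?R"
    show "(Sup S, v) \<in> ?R"
    proof (cases "v = bot \<or> v \<le> V")
      case True
      with * show ?thesis by (auto intro!: Sup_least)
    next
      case False
      with * have "Sup S \<le> bot" by (intro Sup_least) auto
      then show ?thesis by (simp add: bot_unique)
    qed
  next
    fix S u assume *: "\<forall>v\<in>S. (u, v) \<in> ?R"
    show "(u, Sup S) \<in> ?R"
    proof (cases "u = bot \<or> u \<le> U")
      case True
      with * show ?thesis by (auto intro!: Sup_least)
    next
      case False
      with * have "Sup S \<le> bot" by (intro Sup_least) auto
      then show ?thesis by (simp add: bot_unique)
    qed
  qed (auto simp: bot_unique)
  then show "pairs (open_rect U V) \<subseteq> ?R"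
    unfolding open_rect_def pairs_Inf
    by (intro INF_lower2[of "Abs_frame_coprod ?R"]) (simp_all add: pairs_Abs)
  have "(bot, v) \<in> pairs D" "(u, bot) \<in> pairs D" for u v and D :: "('a, 'b) frame_coprod"
    using pairs_Sup1[of "{}" v D] pairs_Sup2[of "{}" u D] by simp_all
  note bots = this
  show "?R \<subseteq> pairs (open_rect U V)"
    unfolding open_rect_def pairs_Inf by (auto simp: bots intro: pairs_down)
qed

lemma open_rect_le_iff: "open_rect u v \<le> D \<longleftrightarrow> (u, v) \<in> pairs D"
proof
  show "open_rect u v \<le> D \<Longrightarrow> (u, v) \<in> pairs D"
    unfolding less_eq_frame_coprod.rep_eq pairs_open_rect by auto
  show "(u, v) \<in> pairs D \<Longrightarrow> open_rect u v \<le> D"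
    unfolding open_rect_def by (auto intro: Inf_lower)
qed

lemma open_rect_eq: "open_rect u v = inf (pr1_inv u) (pr2_inv v)"
proof -
  have "pairs (open_rect u v) = pairs (inf (pr1_inv u) (pr2_inv v))"
    unfolding pairs_inf pr1_inv_def pr2_inv_def pairs_open_rect by auto
  then show ?thesis by (simp add: pairs_inject)
qed

lemma frame_coprod_eq_Sup: "D = Sup ((\<lambda>(u, v). open_rect u v) ` pairs D)"
proof (rule order.antisym)
  show "D \<le> Sup ((\<lambda>(u, v). open_rect u v) ` pairs D)"
    unfolding less_eq_frame_coprod.rep_eq
  proof
    fix p assume p: "p \<in> pairs D"
    obtain u v where uv: "p = (u, v)" by fastforce
    have "open_rect u v \<le> Sup ((\<lambda>(u, v). open_rect u v) ` pairs D)"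
      using p unfolding uv by (intro Sup_upper image_eqI[of _ _ "(u, v)"]) auto
    then show "p \<in> pairs (Sup ((\<lambda>(u, v). open_rect u v) ` pairs D))"
      unfolding uv open_rect_le_iff .
  qed
  show "Sup ((\<lambda>(u, v). open_rect u v) ` pairs D) \<le> D"
    by (rule Sup_least) (auto simp: open_rect_le_iff)
qed

lemma frame_map_mono: "frame_map f \<Longrightarrow> u \<le> v \<Longrightarrow> f u \<le> f v"
  unfolding frame_map_def by (metis inf.absorb_iff2 inf.commute)

lemma frame_map_pr1_inv: "frame_map (pr1_inv :: 'a::frame \<Rightarrow> ('a, 'b::frame) frame_coprod)"
  unfolding frame_map_def
proof (intro conjI allI)
  show "pr1_inv top = (top :: ('a, 'b) frame_coprod)"
    by (simp add: pairs_inject[symmetric] pr1_inv_def pairs_open_rect pairs_top)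
  show "pr1_inv (inf U V) = (inf (pr1_inv U) (pr1_inv V) :: ('a, 'b) frame_coprod)" for U V
    by (auto simp: pairs_inject[symmetric] pr1_inv_def pairs_open_rect pairs_inf)
  show "pr1_inv (Sup A) = (Sup (pr1_inv ` A) :: ('a, 'b) frame_coprod)" for A
  proof (rule order.antisym)
    have "\<forall>u\<in>A. (u, top) \<in> pairs (Sup (pr1_inv ` A) :: ('a, 'b) frame_coprod)"
      unfolding open_rect_le_iff[symmetric] pr1_inv_def by (blast intro: Sup_upper)
    then show "pr1_inv (Sup A) \<le> (Sup (pr1_inv ` A) :: ('a, 'b) frame_coprod)"
      unfolding pr1_inv_def open_rect_le_iff by (rule pairs_Sup1)
    show "(Sup (pr1_inv ` A) :: ('a, 'b) frame_coprod) \<le> pr1_inv (Sup A)"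
      by (rule Sup_least) (auto simp: pr1_inv_def open_rect_le_iff pairs_open_rect intro: Sup_upper)
  qed
qed

lemma frame_map_pr2_inv: "frame_map (pr2_inv :: 'b::frame \<Rightarrow> ('a::frame, 'b) frame_coprod)"
  unfolding frame_map_def
proof (intro conjI allI)
  show "pr2_inv top = (top :: ('a, 'b) frame_coprod)"
    by (simp add: pairs_inject[symmetric] pr2_inv_def pairs_open_rect pairs_top)
  show "pr2_inv (inf U V) = (inf (pr2_inv U) (pr2_inv V) :: ('a, 'b) frame_coprod)" for U V
    by (auto simp: pairs_inject[symmetric] pr2_inv_def pairs_open_rect pairs_inf)
  show "pr2_inv (Sup A) = (Sup (pr2_inv ` A) :: ('a, 'b) frame_coprod)" for A
  proof (rule order.antisym)
    have "\<forall>v\<in>A. (top, v) \<in> pairs (Sup (pr2_inv ` A) :: ('a, 'b) frame_coprod)"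
      unfolding open_rect_le_iff[symmetric] pr2_inv_def by (blast intro: Sup_upper)
    then show "pr2_inv (Sup A) \<le> (Sup (pr2_inv ` A) :: ('a, 'b) frame_coprod)"
      unfolding pr2_inv_def open_rect_le_iff by (rule pairs_Sup2)
    show "(Sup (pr2_inv ` A) :: ('a, 'b) frame_coprod) \<le> pr2_inv (Sup A)"
      by (rule Sup_least) (auto simp: pr2_inv_def open_rect_le_iff pairs_open_rect intro: Sup_upper)
  qed
qed

lemma Sup_inf_frame:
  fixes B :: "'a::frame set"
  shows "inf (Sup B) a = Sup ((\<lambda>b. inf b a) ` B)"
  by (simp add: inf.commute[of _ a] inf_Sup_frame)

theorem frame_coprod_universal:
  fixes f :: "'a::frame \<Rightarrow> 'c::frame" and g :: "'b::frame \<Rightarrow> 'c"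
  assumes f: "frame_map f" and g: "frame_map g"
  shows "\<exists>!h :: ('a, 'b) frame_coprod \<Rightarrow> 'c. frame_map h \<and> h \<circ> pr1_inv = f \<and> h \<circ> pr2_inv = g"
proof (rule ex_ex1I)
  have fg: "f top = top" "g top = top" "\<And>u v. f (inf u v) = inf (f u) (f v)"
    "\<And>u v. g (inf u v) = inf (g u) (g v)" "\<And>A. f (Sup A) = Sup (f ` A)"
    "\<And>A. g (Sup A) = Sup (g ` A)"
    using f g unfolding frame_map_def by auto
  have bots: "f bot = bot" "g bot = bot"
    using fg(5,6)[of "{}"] by auto
  define h :: "('a, 'b) frame_coprod \<Rightarrow> 'c"
    where "h D = Sup ((\<lambda>(u, v). inf (f u) (g v)) ` pairs D)" for D
  have "c_ideal {(u, v). inf (f u) (g v) \<le> c}" for c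
    unfolding c_ideal_def
  proof (intro conjI allI impI)
    fix u v u' v' assume "(u, v) \<in> {(u, v). inf (f u) (g v) \<le> c}" "u' \<le> u" "v' \<le> v"
    then show "(u', v') \<in> {(u, v). inf (f u) (g v) \<le> c}"
      using inf_mono[OF frame_map_mono[OF f, of u' u] frame_map_mono[OF g, of v' v]]
      by (auto intro: order_trans simp del: inf.bounded_iff le_inf_iff)
  qed (auto simp: fg(5,6) Sup_inf_frame inf_Sup_frame intro!: Sup_least)
  note I = pairs_Abs[OF this]
  have adj: "h D \<le> c \<longleftrightarrow> D \<le> Abs_frame_coprod {(u, v). inf (f u) (g v) \<le> c}" for D c
    unfolding h_def less_eq_frame_coprod.rep_eq I by (auto simp: Sup_le_iff)
  have hmono: "h D \<le> h E" if "D \<le> E" for D E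
    using that unfolding h_def less_eq_frame_coprod.rep_eq by (auto intro: Sup_subset_mono)
  have hrect: "h (open_rect u v) = inf (f u) (g v)" for u v
  proof (rule order.antisym)
    show "h (open_rect u v) \<le> inf (f u) (g v)"
      unfolding adj open_rect_le_iff I by simp
    show "inf (f u) (g v) \<le> h (open_rect u v)"
      unfolding h_def by (rule Sup_upper) (auto simp: pairs_open_rect intro!: image_eqI[of _ _ "(u, v)"])
  qed
  have "frame_map h"
    unfolding frame_map_def
  proof (intro conjI allI)
    have "h (open_rect top top) \<le> h top" by (rule hmono) simp
    then show "h top = top" by (simp add: hrect fg top_unique)
  next
    fix D E
    show "h (inf D E) = inf (h D) (h E)"
    proof (rule order.antisym)
      show "h (inf D E) \<le> inf (h D) (h E)" by (simp add: hmono)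
      have "inf (inf (f u) (g v)) (inf (f u') (g v')) \<le> h (inf D E)"
        if "(u, v) \<in> pairs D" "(u', v') \<in> pairs E" for u v u' v'
      proof -
        have "(inf u u', inf v v') \<in> pairs (inf D E)"
          using that by (auto simp: pairs_inf intro: pairs_down)
        then have "inf (f (inf u u')) (g (inf v v')) \<le> h (inf D E)"
          unfolding h_def by (intro Sup_upper image_eqI[of _ _ "(inf u u', inf v v')"]) auto
        then show ?thesis by (simp add: fg ac_simps)
      qed
      then show "inf (h D) (h E) \<le> h (inf D E)"
        unfolding h_def[of D] h_def[of E]
        by (auto simp: Sup_inf_frame inf_Sup_frame image_image intro!: Sup_least)
    qed
  next
    fix A
    show "h (Sup A) = Sup (h ` A)"
    proof (rule order.antisym)
      show "h (Sup A) \<le> Sup (h ` A)"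
        unfolding adj by (rule Sup_least) (auto simp flip: adj intro: Sup_upper)
      show "Sup (h ` A) \<le> h (Sup A)"
        by (rule Sup_least) (auto intro: hmono Sup_upper)
    qed
  qed
  moreover have "h \<circ> pr1_inv = f" "h \<circ> pr2_inv = g"
    by (auto simp: pr1_inv_def pr2_inv_def hrect fg)
  ultimately show "\<exists>h :: ('a, 'b) frame_coprod \<Rightarrow> 'c.
      frame_map h \<and> h \<circ> pr1_inv = f \<and> h \<circ> pr2_inv = g" by blast
next
  fix h k :: "('a, 'b) frame_coprod \<Rightarrow> 'c"
  assume h: "frame_map h \<and> h \<circ> pr1_inv = f \<and> h \<circ> pr2_inv = g"
    and k: "frame_map k \<and> k \<circ> pr1_inv = f \<and> k \<circ> pr2_inv = g"
  have val: "l D = Sup ((\<lambda>(u, v). inf (f u) (g v)) ` pairs D)"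
    if l: "frame_map l \<and> l \<circ> pr1_inv = f \<and> l \<circ> pr2_inv = g" for l :: "('a, 'b) frame_coprod \<Rightarrow> 'c" and D
  proof -
    have "l (open_rect u v) = inf (f u) (g v)" for u v
      using l unfolding open_rect_eq frame_map_def by auto
    then have "l ` (\<lambda>(u, v). open_rect u v) ` pairs D = (\<lambda>(u, v). inf (f u) (g v)) ` pairs D"
      unfolding image_image by (intro image_cong) auto
    then show ?thesis
      using l arg_cong[OF frame_coprod_eq_Sup[of D], of l] unfolding frame_map_def by simp
  qed
  show "h = k" using val[OF h] val[OF k] by auto
qed


subsection \<open>Localic relations and their cones\<close>

text \<open>
  \<open>r\<close> is the inverse image map of \<open>R \<rightarrowtail> X \<times> X\<close>, where \<open>'a\<close> is the frame of opens of \<open>X\<close> and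
  \<open>'r\<close> that of \<open>R\<close>; sublocale inclusions are the locale maps with surjective inverse image map.
\<close>

definition localic_relation :: "(('a::frame, 'a) frame_coprod \<Rightarrow> 'r::frame) \<Rightarrow> bool" where
  "localic_relation r \<longleftrightarrow> frame_map r \<and> surj r"

definition source_inv :: "(('a::frame, 'a) frame_coprod \<Rightarrow> 'r::frame) \<Rightarrow> 'a \<Rightarrow> 'r" where
  "source_inv r = r \<circ> pr1_inv"

definition target_inv :: "(('a::frame, 'a) frame_coprod \<Rightarrow> 'r::frame) \<Rightarrow> 'a \<Rightarrow> 'r" where
  "target_inv r = r \<circ> pr2_inv"

definition has_open_cones :: "(('a::frame, 'a) frame_coprod \<Rightarrow> 'r::frame) \<Rightarrow> bool" where
  "has_open_cones r \<longleftrightarrow> open_locale_map (source_inv r) \<and> open_locale_map (target_inv r)"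

definition up_cone :: "(('a::frame, 'a) frame_coprod \<Rightarrow> 'r::frame) \<Rightarrow> 'a \<Rightarrow> 'a" where
  "up_cone r = direct_image (target_inv r) \<circ> source_inv r"

definition down_cone :: "(('a::frame, 'a) frame_coprod \<Rightarrow> 'r::frame) \<Rightarrow> 'a \<Rightarrow> 'a" where
  "down_cone r = direct_image (source_inv r) \<circ> target_inv r"

definition parallel_cones :: "('a::frame \<Rightarrow> 'a) \<Rightarrow> ('a \<Rightarrow> 'a) \<Rightarrow> bool" where
  "parallel_cones up down \<longleftrightarrow>
     (\<forall>U V. inf (up U) V \<le> up (inf U (down V)) \<and> inf U (down V) \<le> down (inf (up U) V))"

end

theory Submission
  imports Defs
begin

text \<open>
  By Frobenius reciprocity for \<open>t\<close>, the open \<open>\<Up>U \<and> V\<close> is the direct image under \<open>t\<close> of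
  \<open>s\<^sup>-\<^sup>1U \<and> t\<^sup>-\<^sup>1V\<close>; the unit of the adjunction of \<open>s\<close> bounds the latter by
  \<open>s\<^sup>-\<^sup>1(U \<and> \<Down>V)\<close>. The other inequality is the same with \<open>s\<close> and \<open>t\<close> exchanged.
\<close>

lemma left_adjoint_mono: "left_adjoint g f \<Longrightarrow> U \<le> V \<Longrightarrow> g U \<le> g V"
  unfolding left_adjoint_def by (meson order.refl order.trans)

lemma left_adjoint_unit: "left_adjoint g f \<Longrightarrow> U \<le> f (g U)"
  unfolding left_adjoint_def by blast

text \<open>Left adjoints are unique, so the one witnessing openness is
  \<open>direct_image f\<close>, which inherits its Frobenius law.\<close>

lemma open_locale_map_direct_image:
  assumes "open_locale_map f"
  shows left_adjoint_direct_image: "left_adjoint (direct_image f) f"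
    and direct_image_frobenius: "direct_image f (inf U (f V)) = inf (direct_image f U) V"
  using assms unfolding open_locale_map_def by (auto dest: direct_image_eq)

text \<open>Kept general in the span \<open>f\<close>, \<open>g\<close>, so that source and target
  can be inserted in either order.\<close>

lemma direct_image_span_le:
  fixes f :: "'a::frame \<Rightarrow> 'c::frame" and g :: "'b::frame \<Rightarrow> 'c"
  assumes f: "open_locale_map f" and g: "open_locale_map g"
  shows "inf (direct_image g (f U)) V \<le> direct_image g (f (inf U (direct_image f (g V))))"
proof -
  have "inf (f U) (g V) \<le> inf (f U) (f (direct_image f (g V)))"
    by (intro inf_mono order.refl left_adjoint_unit left_adjoint_direct_image f)
  also have "\<dots> = f (inf U (direct_image f (g V)))"
    using f unfolding open_locale_map_def frame_map_def by simp
  finally have "direct_image g (inf (f U) (g V)) \<le> direct_image g (f (inf U (direct_image f (g V))))"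
    by (rule left_adjoint_mono[OF left_adjoint_direct_image[OF g]])
  then show ?thesis
    by (simp only: direct_image_frobenius[OF g])
qed

theorem proposition6p4:
  fixes r :: "('a::frame, 'a) frame_coprod \<Rightarrow> 'r::frame"
  assumes "localic_relation r"
    and "has_open_cones r"
  shows "parallel_cones (up_cone r) (down_cone r)"
proof -
  have s: "open_locale_map (source_inv r)" and t: "open_locale_map (target_inv r)"
    using assms(2) unfolding has_open_cones_def by simp_all
  show ?thesis
    unfolding parallel_cones_def up_cone_def down_cone_def comp_apply
    using direct_image_span_le[OF s t] direct_image_span_le[OF t s]
    \<comment> \<open>The instance for \<open>t\<close>, \<open>s\<close> is used with
      \<open>U\<close> and \<open>V\<close> exchanged, which leaves its meets in reverse
      order.\<close>
    by (simp only: inf.commute) blast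
qed

end
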